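(* Let $\theta>0$. For $(a,b,q)$ with $0\le a\le b\le 1$ and $0\le q\le 1$, let the social welfare be $$\tilde W(a,b,q)=\int_0^1 \max\left\{\theta \sqrt{q}-(i-a)^2,\ \theta\sqrt{1-q}-(i-b)^2\right\}\,di .$$ A social optimum is a triple $(a,b,q)$ that maximizes $\tilde W$ over the set $\{(a,b,q): 0\le a\le b\le 1,\ 0\le q\le 1\}$. If $\theta\in\left(0,\frac{1}{4\sqrt2}\right)$, then the (unique) social optimum is the symmetric configuration $\left(\frac14,\frac34,\frac12\right)$.
   Context: Individuals are uniformly distributed over $I=[0,1]$. A configuration of facilities is a triple $(a,b,q)$ with $0\le a\le b\le 1$ and $0\le q\le 1$: two facilities are located at $a$ and $b$, with qualities $q_a=q$ and $q_b=1-q$ respectively. An individual located at $i\in I$ who consumes the public service at $x\in\{a,b\}$ obtains utility $\tilde u(i,x)=\theta\sqrt{q_x}-(i-x)^2$, where $\theta>0$ is the quality valuation. Each individual uses a facility that maximizes his utility, and social welfare is the integral over $i\in[0,1]$ of the resulting (maximal) utility. This is the function $\tilde W$ in the claim. *)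

theory Defs
  imports "HOL-Analysis.Analysis"
begin

text \<open>Utility of an individual at \<open>i\<close> using a facility of quality \<open>r\<close> located at \<open>x\<close>.\<close>

definition utility :: "real \<Rightarrow> real \<Rightarrow> real \<Rightarrow> real \<Rightarrow> real" where
  "utility \<theta> i x r = \<theta> * sqrt r - (i - x)^2"

text \<open>A configuration \<open>(a, b, q)\<close> has a facility of quality \<open>q\<close> at \<open>a\<close>
  and one of quality \<open>1 - q\<close> at \<open>b\<close>.\<close>

definition configurations :: "(real \<times> real \<times> real) set" where
  "configurations = {(a, b, q). 0 \<le> a \<and> a \<le> b \<and> b \<le> 1 \<and> 0 \<le> q \<and> q \<le> 1}"

definition social_welfare :: "real \<Rightarrow> real \<times> real \<times> real \<Rightarrow> real" where
  "social_welfare \<theta> = (\<lambda>(a, b, q).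
     integral {0..1} (\<lambda>i. max (utility \<theta> i a q) (utility \<theta> i b (1 - q))))"

definition social_optimum :: "real \<Rightarrow> real \<times> real \<times> real \<Rightarrow> bool" where
  "social_optimum \<theta> = is_arg_max (social_welfare \<theta>) (\<lambda>c. c \<in> configurations)"

end

theory Submission
  imports Defs
begin

text \<open>
  The difference of the two utilities is affine and non-increasing in \<open>i\<close>, so the individuals using
  \<open>a\<close> form an initial segment \<open>[0, m]\<close>. For a given \<open>m\<close>, the welfare is largest if both facilities
  are at the midpoints of their catchment areas and, by Cauchy-Schwarz, if \<open>sqrt q : sqrt (1 - q)\<close>
  equals \<open>m : 1 - m\<close>. With \<open>z = (m - 1/2)^2\<close> this maximum is \<open>\<theta> sqrt (1/2 + 2 z) - 1/48 - z/4\<close>,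
  which is concave in \<open>z\<close> and has slope \<open>\<theta> sqrt 2 - 1/4 < 0\<close> at \<open>z = 0\<close>.
\<close>

text \<open>Expanding the cubic antiderivative about the midpoint of \<open>{l..u}\<close> isolates
  the loss from an off-centre facility as one nonnegative term, which vanishes exactly at the
  midpoint when \<open>l < u\<close>.\<close>

lemma utility_has_integral:
  assumes "l \<le> u"
  shows "((\<lambda>i. utility \<theta> i x r) has_integral
    \<theta> * sqrt r * (u - l) - (u - l)^3 / 12 - (u - l) * (x - (l + u) / 2)^2) {l..u}"
proof -
  have "((\<lambda>i. utility \<theta> i x r) has_integral
      (\<theta> * sqrt r * u - (u - x)^3 / 3) - (\<theta> * sqrt r * l - (l - x)^3 / 3)) {l..u}"
    using assms unfolding utility_def
    by (intro fundamental_theorem_of_calculus)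
       (auto intro!: derivative_eq_intros simp: has_real_derivative_iff_has_vector_derivative[symmetric])
  also have "(\<theta> * sqrt r * u - (u - x)^3 / 3) - (\<theta> * sqrt r * l - (l - x)^3 / 3)
      = \<theta> * sqrt r * (u - l) - (u - l)^3 / 12 - (u - l) * (x - (l + u) / 2)^2"
    by (simp add: field_simps power2_eq_square power3_eq_cube)
  finally show ?thesis .
qed

text \<open>Total utility when \<open>[0, m]\<close> is assigned to \<open>a\<close> and
  \<open>[m, 1]\<close> to \<open>b\<close>, whether or not individuals would choose so.\<close>

definition threshold_welfare :: "real \<Rightarrow> real \<Rightarrow> real \<Rightarrow> real \<Rightarrow> real \<Rightarrow> real" where
  "threshold_welfare \<theta> m a b q =
     \<theta> * (sqrt q * m + sqrt (1 - q) * (1 - m)) - (m^3 + (1 - m)^3) / 12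
     - m * (a - m / 2)^2 - (1 - m) * (b - (1 + m) / 2)^2"

lemma social_welfare_threshold:
  assumes m: "0 \<le> m" "m \<le> 1"
    and left: "\<And>i. 0 < i \<Longrightarrow> i < m \<Longrightarrow> utility \<theta> i b (1 - q) \<le> utility \<theta> i a q"
    and right: "\<And>i. m < i \<Longrightarrow> i < 1 \<Longrightarrow> utility \<theta> i a q \<le> utility \<theta> i b (1 - q)"
  shows "social_welfare \<theta> (a, b, q) = threshold_welfare \<theta> m a b q"
proof -
  let ?f = "\<lambda>i. max (utility \<theta> i a q) (utility \<theta> i b (1 - q))"
  let ?L = "\<theta> * sqrt q * (m - 0) - (m - 0)^3 / 12 - (m - 0) * (a - (0 + m) / 2)^2"
  let ?R = "\<theta> * sqrt (1 - q) * (1 - m) - (1 - m)^3 / 12 - (1 - m) * (b - (m + 1) / 2)^2"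
  \<comment> \<open>The maximum is known to equal one of the utilities only on the open interval;
    the endpoints are negligible.\<close>
  have "(?f has_integral ?L) {0..m}"
    by (rule has_integral_spike_interior[OF utility_has_integral[OF m(1), folded box_real(2)],
          unfolded box_real]) (use left in auto)
  moreover have "(?f has_integral ?R) {m..1}"
    by (rule has_integral_spike_interior[OF utility_has_integral[OF m(2), folded box_real(2)],
          unfolded box_real]) (use right in auto)
  ultimately have "(?f has_integral ?L + ?R) {0..1}"
    by (rule has_integral_combine[OF m])
  then show ?thesis
    by (simp add: social_welfare_def threshold_welfare_def integral_unique algebra_simps
        add_divide_distrib)
qed

lemma utility_diff:
  "utility \<theta> i a q - utility \<theta> i b r
     = \<theta> * (sqrt q - sqrt r) - (a^2 - b^2) - 2 * i * (b - a)"
  by (simp add: utility_def algebra_simps power2_eq_square)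

lemma threshold_exists:
  assumes "a \<le> b"
  obtains m where "0 \<le> m" "m \<le> 1"
    "\<And>i. 0 < i \<Longrightarrow> i < m \<Longrightarrow> utility \<theta> i b r \<le> utility \<theta> i a q"
    "\<And>i. m < i \<Longrightarrow> i < 1 \<Longrightarrow> utility \<theta> i a q \<le> utility \<theta> i b r"
proof -
  define D where "D = (\<lambda>i. utility \<theta> i a q - utility \<theta> i b r)"
  have anti: "D j \<le> D i" if "i \<le> j" for i j
    using assms that by (simp add: D_def utility_diff mult_right_mono)
  have cont: "continuous_on {0..1} D"
    unfolding D_def utility_diff by (intro continuous_intros)
  \<comment> \<open>Either nobody strictly gains from \<open>a\<close> (\<open>m = 0\<close>), or
    nobody strictly gains from \<open>b\<close> (\<open>m = 1\<close>), or \<open>D\<close> changes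
    sign and any zero serves as \<open>m\<close>.\<close>
  consider "D 0 \<le> 0" | "D 1 \<ge> 0" | "D 1 \<le> 0" "0 \<le> D 0" by linarith
  then show thesis
  proof cases
    case 1
    then have "D i \<le> 0" if "0 < i" for i
      using anti[of 0 i] that by simp
    then show thesis
      using that[of 0] by (simp add: D_def)
  next
    case 2
    then have "0 \<le> D i" if "i < 1" for i
      using anti[of i 1] that by simp
    then show thesis
      using that[of 1] by (simp add: D_def)
  next
    case 3
    obtain m where "0 \<le> m" "m \<le> 1" "D m = 0"
      using IVT2'[of D 1 0 0] 3 cont by auto
    then show thesis
      using that[of m] anti[of m] anti[of _ m] by (force simp: D_def)
  qed
qed

lemma threshold_welfare_less:
  assumes \<theta>: "0 < \<theta>" "\<theta> < 1 / (4 * sqrt 2)" and m: "0 \<le> m" "m \<le> 1"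
    and q: "0 \<le> q" "q \<le> 1" and ne: "(a, b, q) \<noteq> (1/4, 3/4, 1/2)"
  shows "threshold_welfare \<theta> m a b q < \<theta> / sqrt 2 - 1 / 48"
proof -
  define z where "z = (m - 1/2)^2"
  define S where "S = sqrt q * m + sqrt (1 - q) * (1 - m)"
  \<comment> \<open>\<open>T\<close> is the tangent at \<open>z = 0\<close> to
    \<open>sqrt (1/2 + 2 * z)\<close>, the Cauchy-Schwarz bound on \<open>S\<close>; a linear bound
    replaces the concavity argument.\<close>
  define T where "T = 1 / sqrt 2 + sqrt 2 * z"
  have z: "0 \<le> z" by (simp add: z_def)
  have slope: "\<theta> * sqrt 2 < 1 / 4" using \<theta> by (simp add: field_simps)
  have cubes: "m^3 + (1 - m)^3 = 1/4 + 3 * z"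
    by (simp add: z_def field_simps power2_eq_square power3_eq_cube)
  \<comment> \<open>Lagrange's identity: the remainder in Cauchy-Schwarz is kept, since it later
    yields strictness in \<open>q\<close>.\<close>
  have "S^2 + (sqrt q * (1 - m) - sqrt (1 - q) * m)^2
      = ((sqrt q)^2 + (sqrt (1 - q))^2) * (m^2 + (1 - m)^2)"
    by (simp only: S_def) algebra
  also have "\<dots> = 1/2 + 2 * z"
    using q by (simp add: z_def field_simps power2_eq_square)
  finally have Lagrange: "S^2 + (sqrt q * (1 - m) - sqrt (1 - q) * m)^2 = 1/2 + 2 * z" .
  have T2: "T^2 = 1/2 + 2 * z + 2 * z^2"
    by (simp add: T_def power2_sum power_divide power_mult_distrib)
  have T0: "0 \<le> T" using z by (simp add: T_def)
  have "S^2 \<le> T^2"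
    using Lagrange T2 by (smt (verit) zero_le_power2)
  then have ST: "S \<le> T" using T0 by (rule power2_le_imp_le)
  have W: "threshold_welfare \<theta> m a b q
      = \<theta> * S - 1/48 - z/4 - m * (a - m / 2)^2 - (1 - m) * (b - (1 + m) / 2)^2"
    unfolding threshold_welfare_def cubes S_def[symmetric] by (simp add: field_simps)
  have slack: "0 \<le> m * (a - m / 2)^2" "0 \<le> (1 - m) * (b - (1 + m) / 2)^2"
    using m by simp_all
  have \<theta>T: "\<theta> * T - z / 4 = \<theta> / sqrt 2 + (\<theta> * sqrt 2 - 1 / 4) * z"
    by (simp add: T_def algebra_simps)
  have \<theta>S: "\<theta> * S \<le> \<theta> * T" using ST \<theta> by simp
  \<comment> \<open>Strictness has three sources: the negative slope if \<open>z\<close> is nonzero;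
    otherwise the Lagrange remainder if \<open>q\<close> differs from \<open>1/2\<close>; otherwise
    a misplaced facility, both catchment areas having length \<open>1/2\<close>.\<close>
  show ?thesis
  proof (cases "z = 0")
    case False
    then have "(\<theta> * sqrt 2 - 1 / 4) * z < 0"
      using z slope by (simp add: mult_neg_pos)
    then show ?thesis using W slack \<theta>T \<theta>S by linarith
  next
    case True
    then have m_half: "m = 1/2" by (simp add: z_def)
    show ?thesis
    proof (cases "q = 1/2")
      case False
      then have "sqrt q \<noteq> sqrt (1 - q)" by simp
      then have "0 < (sqrt q * (1 - m) - sqrt (1 - q) * m)^2"
        by (simp add: m_half)
      then have "S^2 < T^2" using Lagrange T2 zero_le_power2[of z] by linarith
      then have "S < T" using T0 by (rule power2_less_imp_less)
      then have "\<theta> * S < \<theta> * T" using \<theta> by simp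
      then show ?thesis using W slack \<theta>T True by simp
    next
      case True
      with ne have "a \<noteq> 1/4 \<or> b \<noteq> 3/4" by simp
      then have "0 < m * (a - m / 2)^2 \<or> 0 < (1 - m) * (b - (1 + m) / 2)^2"
        by (simp add: m_half)
      then show ?thesis using W slack \<theta>T \<theta>S \<open>z = 0\<close> by auto
    qed
  qed
qed

lemma social_welfare_symmetric:
  "social_welfare \<theta> (1/4, 3/4, 1/2) = \<theta> / sqrt 2 - 1 / 48"
proof -
  \<comment> \<open>With equal qualities the indifferent individual is midway between the
    facilities, so \<open>m = 1/2\<close>.\<close>
  have "social_welfare \<theta> (1/4, 3/4, 1/2) = threshold_welfare \<theta> (1/2) (1/4) (3/4) (1/2)"
    by (rule social_welfare_threshold) (auto simp: utility_def power2_eq_square algebra_simps)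
  then show ?thesis
    by (simp add: threshold_welfare_def real_sqrt_divide power3_eq_cube field_simps)
qed

theorem theorem2:
  fixes \<theta> :: real and c :: "real \<times> real \<times> real"
  assumes "0 < \<theta>" and "\<theta> < 1 / (4 * sqrt 2)"
  shows "social_optimum \<theta> c \<longleftrightarrow> c = (1/4, 3/4, 1/2)"
proof -
  have less: "social_welfare \<theta> d < social_welfare \<theta> (1/4, 3/4, 1/2)"
    if d: "d \<in> configurations" "d \<noteq> (1/4, 3/4, 1/2)" for d
  proof -
    obtain a b q where d_eq: "d = (a, b, q)" by (cases d)
    with d have "a \<le> b" and q: "0 \<le> q" "q \<le> 1" by (auto simp: configurations_def)
    from \<open>a \<le> b\<close> obtain m where "0 \<le> m" "m \<le> 1"
        and "social_welfare \<theta> (a, b, q) = threshold_welfare \<theta> m a b q"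
      by (rule threshold_exists[of a b \<theta> "1 - q" q]) (blast intro: social_welfare_threshold)
    with threshold_welfare_less[OF assms _ _ q] d(2) show ?thesis
      unfolding d_eq social_welfare_symmetric by metis
  qed
  moreover have "(1/4, 3/4, 1/2) \<in> configurations"
    by (simp add: configurations_def)
  \<comment> \<open>Strict domination of every other configuration gives both optimality and
    uniqueness.\<close>
  ultimately show ?thesis
    unfolding social_optimum_def is_arg_max_def by (metis less_asym)
qed

end
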